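(* Let $\eta,\ell\in\mathbb{R}$ with $\ell>-3/2$, $\ell\neq-1$ and $\eta\neq0$. If $h\ge-\ell-1$ is real, then the function $xF_{\ell,\eta}'(x)+hF_{\ell,\eta}(x)$ has only real zeros.
   Context: For real $\eta$ and $\ell>-3/2$, $\ell\neq-1$, the regular Coulomb wave function is $$F_{\ell,\eta}(x)=C_{\ell,\eta}\,x^{\ell+1}\phi_{\ell,\eta}(x),\qquad C_{\ell,\eta}=\frac{2^{\ell}e^{-\pi\eta/2}|\Gamma(\ell+1+i\eta)|}{\Gamma(2\ell+2)},$$ $$\phi_{\ell,\eta}(x)=e^{-ix}\,{}_1F_1(\ell+1-i\eta,\,2\ell+2;\,2ix),\qquad {}_1F_1(a,b;z)=\sum_{k\ge0}\frac{(a)_k}{(b)_k}\frac{z^k}{k!},$$ where $(a)_k=\Gamma(a+k)/\Gamma(a)$. Here $x$ is a complex variable, $\phi_{\ell,\eta}$ is entire, and powers of $x$ use the principal branch $-\pi<\arg x\le\pi$, so that for $x\ne0$ $$xF_{\ell,\eta}'(x)+hF_{\ell,\eta}(x)=C_{\ell,\eta}x^{\ell+1}\left(x\phi_{\ell,\eta}'(x)+(h+\ell+1)\phi_{\ell,\eta}(x)\right).$$ *)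

theory Defs
  imports "HOL-Analysis.Analysis"
begin

text \<open>
  Kummer's confluent hypergeometric function. The quotient \<open>Gamma (a + k) / Gamma a\<close> is
  \<^const>\<open>pochhammer\<close> whenever \<open>a\<close> is not a nonpositive integer (\<open>pochhammer_Gamma\<close>); this
  covers all parameters \<open>l + 1 - i\<eta>\<close> and \<open>2l + 2\<close> with \<open>l > -3/2\<close>, \<open>l \<noteq> -1\<close>.
\<close>
definition hyp1F1 :: "complex \<Rightarrow> complex \<Rightarrow> complex \<Rightarrow> complex" where
  "hyp1F1 a b z = (\<Sum>k. pochhammer a k / pochhammer b k * (z ^ k / fact k))"

definition coulomb_C :: "real \<Rightarrow> real \<Rightarrow> real" where
  "coulomb_C l \<eta> =
     2 powr l * exp (- (pi * \<eta>) / 2) * cmod (Gamma (of_real l + 1 + \<i> * of_real \<eta>))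
       / Gamma (2 * l + 2)"

definition coulomb_phi :: "real \<Rightarrow> real \<Rightarrow> complex \<Rightarrow> complex" where
  "coulomb_phi l \<eta> x =
     exp (- (\<i> * x)) *
       hyp1F1 (of_real l + 1 - \<i> * of_real \<eta>) (2 * of_real l + 2) (2 * \<i> * x)"

text \<open>
  Complex \<open>powr\<close> is the principal branch with argument in \<open>(-\<pi>, \<pi>]\<close>. For non-integer \<open>l\<close>
  the function is therefore discontinuous across the negative real axis, where its complex
  \<^const>\<open>deriv\<close> carries no information; it is holomorphic off the real axis.
\<close>
definition coulomb_F :: "real \<Rightarrow> real \<Rightarrow> complex \<Rightarrow> complex" where
  "coulomb_F l \<eta> x =
     of_real (coulomb_C l \<eta>) * x powr (of_real l + 1) * coulomb_phi l \<eta> x"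

end

theory Submission imports Defs begin

text \<open>
  Write \<open>\<phi>\<close> for the entire factor of \<open>F\<close>, \<open>p = 2l + 2 > -1\<close> and \<open>H = h + l + 1 \<ge> 0\<close>. Off the real
  axis, \<open>x F' + h F\<close> is a nonvanishing multiple of \<open>x \<phi>' + H \<phi>\<close>, and Kummer's equation for
  \<open>\<^sub>1F\<^sub>1\<close> turns into \<open>x \<phi>'' + p \<phi>' + (x - 2\<eta>) \<phi> = 0\<close>.

  Suppose \<open>z \<phi>'(z) + H \<phi>(z) = 0\<close> with \<open>y = Im z \<noteq> 0\<close>, and move along the ray from \<open>0\<close> to \<open>z\<close>. Since
  \<open>\<eta>\<close> is real, the equation yields
  \<open>d/dt (t\<^sup>p Im (\<phi>'(tz) cnj (\<phi>(tz)))) = - t\<^sup>p y (\<bar>\<phi>(tz)\<bar>\<^sup>2 + \<bar>\<phi>'(tz)\<bar>\<^sup>2)\<close>.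
  The equation at \<open>0\<close> makes \<open>\<phi>'(0)\<close> a real multiple of \<open>\<phi>(0)\<close>, so the differentiated quantity is
  \<open>O(t\<^sup>p\<^sup>+\<^sup>1)\<close> and tends to \<open>0\<close> with \<open>t\<close>, because \<open>p > -1\<close>; this holds even in the range
  \<open>-3/2 < l < -1\<close>, where \<open>t\<^sup>p\<close> itself blows up. Multiplied by \<open>y\<close>, the quantity is therefore
  nonincreasing from the limit \<open>0\<close>. At \<open>t = 1\<close>, however, the assumed zero gives it the value
  \<open>y\<^sup>2 H \<bar>\<phi>(z)\<bar>\<^sup>2 / \<bar>z\<bar>\<^sup>2 \<ge> 0\<close>. Hence it vanishes identically, \<open>\<phi>\<close> vanishes along the ray, and this
  contradicts \<open>\<phi>(0) = 1\<close>. Since this argument sees only the differential equation and \<open>\<phi>(0) \<noteq> 0\<close>, it is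
  carried out for any such entire function in \<open>ray_no_nonreal_zeros\<close>.
\<close>

section \<open>Kummer's differential equation\<close>

definition kummer_coeff :: "complex \<Rightarrow> complex \<Rightarrow> nat \<Rightarrow> complex" where
  "kummer_coeff a b k = pochhammer a k / (pochhammer b k * fact k)"

definition kummer_deriv :: "nat \<Rightarrow> complex \<Rightarrow> complex \<Rightarrow> complex \<Rightarrow> complex" where
  "kummer_deriv n a b z = (\<Sum>k. (diffs ^^ n) (kummer_coeff a b) k * z ^ k)"

lemma hyp1F1_eq_kummer_deriv: "hyp1F1 a b = kummer_deriv 0 a b"
  by (simp add: hyp1F1_def kummer_deriv_def kummer_coeff_def fun_eq_iff)

lemma kummer_coeff_Suc:
  assumes "\<And>k. b + of_nat k \<noteq> 0"
  shows "(of_nat k + 1) * (b + of_nat k) * kummer_coeff a b (Suc k)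
           = (a + of_nat k) * kummer_coeff a b k"
proof -
  have 1: "of_nat k + 1 \<noteq> (0::complex)"
    using of_nat_neq_0[of k, where 'a = complex] by (simp add: add.commute)
  have "pochhammer b k \<noteq> 0"
    using assms by (auto simp: pochhammer_eq_0_iff add_eq_0_iff2)
  with 1 assms[of k] show ?thesis
    by (simp add: kummer_coeff_def pochhammer_Suc divide_simps) (simp add: algebra_simps)
qed

lemma summable_kummer_coeff:
  assumes b: "\<And>k. b + of_nat k \<noteq> 0"
  shows "summable (\<lambda>k. kummer_coeff a b k * z ^ k)"
proof -
  (* past N, norm (a + k) <= 2k, norm (b + k) >= k/2 and norm z <= k/8: term ratios are at most 1/2 *)
  obtain N :: nat where N: "real N \<ge> max (max (norm a) (2 * norm b)) (max 1 (8 * norm z))"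
    using real_arch_simple by blast
  show ?thesis
  proof (rule summable_ratio_test[where c = "1/2" and N = N])
    fix k assume "k \<ge> N"
    then have "real k \<ge> real N" by simp
    with N have k: "norm a \<le> k" "2 * norm b \<le> k" "1 \<le> k" "8 * norm z \<le> k" by linarith+
    have "norm (a + of_nat k) \<le> 2 * k"
      using norm_triangle_ineq[of a "of_nat k"] k by simp
    then have n1: "norm (a + of_nat k) * norm z \<le> 2 * k * (k / 8)"
      using k by (intro mult_mono) auto
    have "norm (b + of_nat k) \<ge> k / 2"
      using norm_diff_ineq[of "of_nat k" b] k by (simp add: add.commute)
    then have n2: "(k + 1) * norm (b + of_nat k) \<ge> (k + 1) * (k / 2)"
      by (intro mult_left_mono) auto
    have n3: "norm (of_nat k + 1 :: complex) = k + 1"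
      using norm_of_nat[of "Suc k", where 'a = complex] by (simp add: add.commute)
    let ?A = "norm (kummer_coeff a b k * z ^ k)"
    let ?B = "norm (kummer_coeff a b (Suc k) * z ^ Suc k)"
    have "(k + 1) * norm (b + of_nat k) * ?B
        = norm ((of_nat k + 1) * (b + of_nat k) * kummer_coeff a b (Suc k)) * norm z ^ Suc k"
      by (simp only: norm_mult norm_power n3 mult_ac)
    also have "\<dots> = norm (a + of_nat k) * norm z * ?A"
      unfolding kummer_coeff_Suc[OF b] by (simp add: norm_mult norm_power)
    also have "\<dots> \<le> 2 * k * (k / 8) * ?A"
      using n1 by (intro mult_right_mono) auto
    also have "\<dots> \<le> (k + 1) * (k / 2) * (1/2 * ?A)"
      by (simp add: algebra_simps divide_simps)
    also have "\<dots> \<le> (k + 1) * norm (b + of_nat k) * (1/2 * ?A)"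
      using n2 by (intro mult_right_mono) auto
    finally have "((k + 1) * norm (b + of_nat k)) * ?B
        \<le> ((k + 1) * norm (b + of_nat k)) * (1/2 * ?A)" .
    moreover have "(k + 1) * norm (b + of_nat k) > 0" using b[of k] by (simp add: add_pos_pos)
    ultimately show "?B \<le> 1/2 * ?A" by (simp only: mult_le_cancel_left_pos)
  qed simp
qed

lemma summable_kummer_deriv:
  assumes "\<And>k. b + of_nat k \<noteq> 0"
  shows "summable (\<lambda>k. (diffs ^^ n) (kummer_coeff a b) k * z ^ k)"
proof (induction n arbitrary: z)
  case 0
  show ?case using summable_kummer_coeff[OF assms] by simp
next
  case (Suc n)
  then show ?case using termdiff_converges_all[of "(diffs ^^ n) (kummer_coeff a b)"] by simp
qed

lemma has_field_derivative_kummer_deriv: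
  assumes "\<And>k. b + of_nat k \<noteq> 0"
  shows "(kummer_deriv n a b has_field_derivative kummer_deriv (Suc n) a b z) (at z)"
  unfolding kummer_deriv_def[abs_def]
  using termdiffs_strong_converges_everywhere[OF summable_kummer_deriv[OF assms, of n a]] by simp

lemma kummer_ode:
  assumes b: "\<And>k. b + of_nat k \<noteq> 0"
  shows "z * kummer_deriv 2 a b z + (b - z) * kummer_deriv 1 a b z - a * kummer_deriv 0 a b z = 0"
proof -
  let ?c = "kummer_coeff a b"
  have s: "(\<lambda>k. (diffs ^^ n) ?c k * z ^ k) sums kummer_deriv n a b z" for n
    unfolding kummer_deriv_def by (intro summable_sums summable_kummer_deriv b)
  (* multiplication by z undoes the index shift of termwise differentiation *)
  have t: "(\<lambda>k. of_nat k * (diffs ^^ n) ?c k * z ^ k) sums (z * kummer_deriv (Suc n) a b z)" for n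
  proof -
    have "(\<lambda>k. of_nat k * (diffs ^^ n) ?c k * z ^ (k - Suc 0)) sums kummer_deriv (Suc n) a b z"
      using diffs_equiv[of "(diffs ^^ n) ?c" z] summable_kummer_deriv[OF b, of "Suc n" a z]
      by (simp add: kummer_deriv_def)
    from sums_mult[OF this, of z] show ?thesis
    proof (rule sums_cong[THEN iffD1, rotated])
      fix k
      show "z * (of_nat k * (diffs ^^ n) ?c k * z ^ (k - Suc 0)) = of_nat k * (diffs ^^ n) ?c k * z ^ k"
        by (cases k) simp_all
    qed
  qed
  have "(\<lambda>k. of_nat k * (diffs ^^ 1) ?c k * z ^ k + b * ((diffs ^^ 1) ?c k * z ^ k)
          - of_nat k * (diffs ^^ 0) ?c k * z ^ k - a * ((diffs ^^ 0) ?c k * z ^ k))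
      sums (z * kummer_deriv (Suc 1) a b z + b * kummer_deriv 1 a b z
          - z * kummer_deriv (Suc 0) a b z - a * kummer_deriv 0 a b z)"
    by (intro sums_add sums_diff sums_mult s t)
  moreover have "of_nat k * (diffs ^^ 1) ?c k * z ^ k + b * ((diffs ^^ 1) ?c k * z ^ k)
      - of_nat k * (diffs ^^ 0) ?c k * z ^ k - a * ((diffs ^^ 0) ?c k * z ^ k) = 0" for k
  proof -
    have "of_nat k * (diffs ^^ 1) ?c k * z ^ k + b * ((diffs ^^ 1) ?c k * z ^ k)
          - of_nat k * (diffs ^^ 0) ?c k * z ^ k - a * ((diffs ^^ 0) ?c k * z ^ k)
        = ((of_nat k + 1) * (b + of_nat k) * ?c (Suc k) - (a + of_nat k) * ?c k) * z ^ k"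
      by (simp add: diffs_def algebra_simps)
    then show ?thesis using kummer_coeff_Suc[OF b, of k a] by simp
  qed
  ultimately have "(\<lambda>k. 0) sums (z * kummer_deriv (Suc 1) a b z + b * kummer_deriv 1 a b z
          - z * kummer_deriv (Suc 0) a b z - a * kummer_deriv 0 a b z)"
    by simp
  from sums_unique2[OF this sums_zero] show ?thesis by (simp add: algebra_simps numeral_2_eq_2)
qed

section \<open>Monotonicity along a ray\<close>

text \<open>
  The monotone quantity is \<open>Im z \<cdot> D t\<close> with \<open>D t = t\<^sup>p Im (f'(tz) cnj (f(tz)))\<close>. The extra factor
  \<open>Im z\<close> treats both half planes at once.
\<close>
lemma ray_no_nonreal_zeros:
  fixes f f' f'' :: "complex \<Rightarrow> complex" and p c H :: real
  assumes f: "\<And>x. (f has_field_derivative f' x) (at x)"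
    and f': "\<And>x. (f' has_field_derivative f'' x) (at x)"
    and ode: "\<And>x. x * f'' x + of_real p * f' x + (x - of_real c) * f x = 0"
    and f0: "f 0 \<noteq> 0" and p: "p > -1" "p \<noteq> 0" and H: "H \<ge> 0"
    and z: "z * f' z + of_real H * f z = 0"
  shows "z \<in> \<real>"
proof (rule ccontr)
  assume "z \<notin> \<real>"
  define y where "y = Im z"
  have y: "y \<noteq> 0" using \<open>z \<notin> \<real>\<close> by (simp add: y_def complex_is_Real_iff)
  then have z0: "z \<noteq> 0" by (auto simp: y_def)
  define G where "G t = Im (f' (of_real t * z) * cnj (f (of_real t * z)))" for t
  define G' where "G' t = Im (z * f'' (of_real t * z) * cnj (f (of_real t * z)))
      - y * (cmod (f' (of_real t * z)))\<^sup>2" for t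
  define D where "D t = t powr p * G t" for t
  define q where "q t = (cmod (f (of_real t * z)))\<^sup>2 + (cmod (f' (of_real t * z)))\<^sup>2" for t

  have ray: "((\<lambda>t. u (of_real t * z)) has_vector_derivative z * u' (of_real t * z)) (at t)"
    if "\<And>x. (u has_field_derivative u' x) (at x)" for u u' :: "complex \<Rightarrow> complex" and t
  proof -
    have "((\<lambda>t. of_real t * z) has_vector_derivative z) (at t)"
      by (auto intro!: derivative_eq_intros)
    from field_vector_diff_chain_at[OF this that] show ?thesis by (simp add: o_def)
  qed
  have dG: "(G has_real_derivative G' t) (at t)" for t
  proof -
    let ?x = "of_real t * z"
    have "((\<lambda>t. cnj (f (of_real t * z))) has_vector_derivative cnj (z * f' ?x)) (at t)"
      by (rule has_vector_derivative_cnj[OF ray[OF f]])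
    from has_vector_derivative_mult[OF ray[OF f'] this]
    have "((\<lambda>t. f' (of_real t * z) * cnj (f (of_real t * z))) has_vector_derivative
        f' ?x * cnj (z * f' ?x) + z * f'' ?x * cnj (f ?x)) (at t)" .
    from bounded_linear.has_vector_derivative[OF bounded_linear_Im this]
    have "(G has_vector_derivative Im (f' ?x * cnj (z * f' ?x) + z * f'' ?x * cnj (f ?x))) (at t)"
      by (simp only: G_def[abs_def])
    moreover have sq: "f' ?x * cnj (z * f' ?x) = cnj z * of_real ((cmod (f' ?x))\<^sup>2)"
      by (simp add: complex_norm_square mult_ac del: of_real_power)
    moreover have "Im (f' ?x * cnj (z * f' ?x) + z * f'' ?x * cnj (f ?x)) = G' t"
      unfolding sq G'_def y_def by (simp del: of_real_power)
    ultimately show ?thesis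
      by (simp only: has_real_derivative_iff_has_vector_derivative)
  qed
  have key: "p * G t + t * G' t = - t * y * q t" for t
  proof -
    let ?x = "of_real t * z"
    have "p * G t + t * G' t
        = Im ((?x * f'' ?x + of_real p * f' ?x) * cnj (f ?x)) - t * y * (cmod (f' ?x))\<^sup>2"
      by (simp add: G_def G'_def algebra_simps)
    also have "?x * f'' ?x + of_real p * f' ?x = - (?x - of_real c) * f ?x"
      using ode[of ?x] unfolding mult_minus_left by (simp only: add_eq_0_iff2)
    also have "- (?x - of_real c) * f ?x * cnj (f ?x)
        = of_real (- (cmod (f ?x))\<^sup>2) * (?x - of_real c)"
      unfolding of_real_minus complex_norm_square by (simp add: algebra_simps)
    finally show ?thesis by (simp add: q_def y_def algebra_simps del: of_real_power)
  qed
  have dD: "(D has_real_derivative - (t powr p) * y * q t) (at t)" if "t > 0" for t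
  proof -
    have "(D has_real_derivative p * t powr (p - 1) * G t + t powr p * G' t) (at t)"
      unfolding D_def[abs_def] using that by (auto intro!: derivative_eq_intros dG)
    also have "p * t powr (p - 1) * G t + t powr p * G' t = t powr (p - 1) * (p * G t + t * G' t)"
      using that by (simp add: powr_diff field_simps)
    also have "\<dots> = - (t powr p) * y * q t"
      unfolding key using that by (simp add: powr_diff field_simps)
    finally show ?thesis .
  qed

  (* the equation at 0 reads p f' 0 = c f 0 with real p, c *)
  have "G 0 = 0"
  proof -
    have "f' 0 = of_real (c / p) * f 0" using ode[of 0] p by (simp add: field_simps)
    then have "f' 0 * cnj (f 0) = of_real (c / p * (cmod (f 0))\<^sup>2)"
      unfolding of_real_mult complex_norm_square by (simp add: mult_ac)
    then show ?thesis by (simp add: G_def del: of_real_mult of_real_divide)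
  qed
  have D0: "(D \<longlongrightarrow> 0) (at_right 0)"
  proof -
    have "((\<lambda>t. G t / t) \<longlongrightarrow> G' 0) (at_right 0)"
      using dG[of 0] \<open>G 0 = 0\<close>
      by (auto simp: has_field_derivative_iff intro: tendsto_mono[OF at_within_le_at])
    moreover have "((\<lambda>t::real. t powr (p + 1)) \<longlongrightarrow> 0) (at_right 0)"
      using p by (intro tendsto_zero_powrI[of _ _ _ "p + 1"] tendsto_ident_at tendsto_const)
        (auto intro: eventually_mono[OF eventually_at_right_less])
    ultimately have "((\<lambda>t. t powr (p + 1) * (G t / t)) \<longlongrightarrow> 0 * G' 0) (at_right 0)"
      by (intro tendsto_mult)
    moreover have "\<forall>\<^sub>F t in at_right 0. t powr (p + 1) * (G t / t) = D t"
      using eventually_at_right_less[of "0::real"]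
      by eventually_elim (simp add: D_def powr_add)
    ultimately show ?thesis by (simp add: filterlim_cong[OF refl refl])
  qed

  have mono: "y * D t \<le> y * D s" if "0 < s" "s \<le> t" for s t
  proof (rule DERIV_nonpos_imp_nonincreasing[OF that(2)])
    fix u assume "s \<le> u" "u \<le> t"
    with that have "u > 0" by simp
    have "((\<lambda>t. y * D t) has_real_derivative y * (- (u powr p) * y * q u)) (at u)"
      by (intro DERIV_cmult dD \<open>u > 0\<close>)
    moreover have "y * (- (u powr p) * y * q u) \<le> 0"
    proof -
      have "y * (- (u powr p) * y * q u) = - (y\<^sup>2 * (u powr p * q u))"
        by (simp add: power2_eq_square)
      also have "\<dots> \<le> 0" by (simp add: q_def)
      finally show ?thesis .
    qed
    ultimately show "\<exists>d. ((\<lambda>t. y * D t) has_real_derivative d) (at u) \<and> d \<le> 0" by blast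
  qed
  have upper: "y * D t \<le> 0" if "t > 0" for t
  proof (rule tendsto_lowerbound)
    show "((\<lambda>s. y * D s) \<longlongrightarrow> 0) (at_right 0)"
      using tendsto_mult[OF tendsto_const D0, of y] by simp
    show "\<forall>\<^sub>F s in at_right 0. y * D t \<le> y * D s"
      using eventually_at_right_real[OF that] by eventually_elim (auto intro: mono)
  qed simp
  have "y * D 1 \<ge> 0"
  proof -
    have "f' z = - (of_real H * f z) / z" using z z0 by (simp add: field_simps add_eq_0_iff)
    then have "f' z * cnj (f z) = of_real (- H * (cmod (f z))\<^sup>2) * inverse z"
      unfolding of_real_mult of_real_minus complex_norm_square by (simp add: field_simps)
    then have "G 1 = - H * (cmod (f z))\<^sup>2 * Im (inverse z)"
      by (simp add: G_def del: of_real_mult of_real_power)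
    also have "\<dots> = H * (cmod (f z))\<^sup>2 * (y / (cmod z)\<^sup>2)"
      by (simp add: y_def cmod_power2)
    finally have "y * D 1 = H * (cmod (f z))\<^sup>2 * y\<^sup>2 / (cmod z)\<^sup>2"
      by (simp add: D_def power2_eq_square)
    then show ?thesis using H by simp
  qed
  have zero: "D t = 0" if "0 < t" "t \<le> 1" for t
  proof -
    have "y * D t = 0" using \<open>y * D 1 \<ge> 0\<close> mono[OF that] upper[OF that(1)] by linarith
    with y show ?thesis by simp
  qed

  have f_zero: "f (of_real t * z) = 0" if t: "0 < t" "t < 1" for t
  proof -
    have "(D has_real_derivative 0) (at t)"
      by (rule has_field_derivative_transform_within_open[OF DERIV_const[of 0], of "{0<..<1}"])
         (use t zero in auto)
    from DERIV_unique[OF this dD[OF t(1)]] have "q t = 0" using t y by simp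
    then show ?thesis by (simp add: q_def add_nonneg_eq_0_iff)
  qed
  have "((\<lambda>t. f (of_real t * z)) \<longlongrightarrow> f (of_real 0 * z)) (at_right 0)"
    using has_vector_derivative_continuous[OF ray[OF f], of 0]
    by (auto simp: continuous_within intro: tendsto_mono[OF at_within_le_at])
  moreover have "\<forall>\<^sub>F t in at_right 0. f (of_real t * z) = 0"
    using eventually_at_right_real[OF zero_less_one] by eventually_elim (auto intro: f_zero)
  ultimately have "((\<lambda>_. 0) \<longlongrightarrow> f (of_real 0 * z)) (at_right (0::real))"
    by (rule Lim_transform_eventually)
  then have "f 0 = 0" by (simp add: tendsto_const_iff)
  with f0 show False ..
qed

section \<open>The Coulomb wave function\<close>

definition coulomb_phi' :: "real \<Rightarrow> real \<Rightarrow> complex \<Rightarrow> complex" where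
  "coulomb_phi' l \<eta> x =
     (let a = of_real l + 1 - \<i> * of_real \<eta>; b = 2 * of_real l + 2; w = 2 * \<i> * x in
      exp (- (\<i> * x)) * \<i> * (2 * kummer_deriv 1 a b w - kummer_deriv 0 a b w))"

definition coulomb_phi'' :: "real \<Rightarrow> real \<Rightarrow> complex \<Rightarrow> complex" where
  "coulomb_phi'' l \<eta> x =
     (let a = of_real l + 1 - \<i> * of_real \<eta>; b = 2 * of_real l + 2; w = 2 * \<i> * x in
      - exp (- (\<i> * x)) * (4 * kummer_deriv 2 a b w - 4 * kummer_deriv 1 a b w
        + kummer_deriv 0 a b w))"

lemma coulomb_denominator_nonzero:
  fixes l :: real
  assumes "l > -3/2" "l \<noteq> -1"
  shows "2 * of_real l + 2 + of_nat k \<noteq> (0::complex)"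
proof
  assume "2 * of_real l + 2 + of_nat k = (0::complex)"
  then have "2 * l + 2 + real k = 0" by (auto simp: complex_eq_iff)
  with assms show False by (cases k) auto
qed

lemma has_field_derivative_kummer_scaled:
  assumes "\<And>k. b + of_nat k \<noteq> 0"
  shows "((\<lambda>x. kummer_deriv n a b (2 * \<i> * x)) has_field_derivative
           2 * \<i> * kummer_deriv (Suc n) a b (2 * \<i> * x)) (at x)"
proof -
  have "((\<lambda>x. 2 * \<i> * x) has_field_derivative 2 * \<i>) (at x)"
    by (auto intro!: derivative_eq_intros)
  from DERIV_chain2[OF has_field_derivative_kummer_deriv[OF assms] this]
  show ?thesis by (simp add: mult_ac)
qed

lemma has_field_derivative_coulomb_phi:
  assumes "l > -3/2" "l \<noteq> -1"
  shows "(coulomb_phi l \<eta> has_field_derivative coulomb_phi' l \<eta> x) (at x)"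
  unfolding coulomb_phi_def[abs_def] coulomb_phi'_def Let_def hyp1F1_eq_kummer_deriv
  by (rule derivative_eq_intros has_field_derivative_kummer_scaled
      coulomb_denominator_nonzero[OF assms] refl)+ (simp add: algebra_simps)

lemma has_field_derivative_coulomb_phi':
  assumes "l > -3/2" "l \<noteq> -1"
  shows "(coulomb_phi' l \<eta> has_field_derivative coulomb_phi'' l \<eta> x) (at x)"
  unfolding coulomb_phi'_def[abs_def] coulomb_phi''_def Let_def
  by (rule derivative_eq_intros has_field_derivative_kummer_scaled
      coulomb_denominator_nonzero[OF assms] refl)+ (simp add: algebra_simps numeral_2_eq_2)

text \<open>
  Kummer's equation at \<open>w = 2ix\<close>. The imaginary terms cancel because the parameters satisfy
  \<open>a = b/2 - i\<eta>\<close>: the factor \<open>exp (-ix)\<close> absorbs the \<open>b/2\<close> and leaves the real coefficient \<open>-2\<eta>\<close>.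
\<close>
lemma coulomb_phi_ode:
  assumes "l > -3/2" "l \<noteq> -1"
  shows "x * coulomb_phi'' l \<eta> x + of_real (2 * l + 2) * coulomb_phi' l \<eta> x
           + (x - of_real (2 * \<eta>)) * coulomb_phi l \<eta> x = 0"
proof -
  let ?a = "of_real l + 1 - \<i> * of_real \<eta> :: complex" and ?b = "2 * of_real l + 2 :: complex"
  let ?K = "\<lambda>n. kummer_deriv n ?a ?b (2 * \<i> * x)"
  have "x * coulomb_phi'' l \<eta> x + of_real (2 * l + 2) * coulomb_phi' l \<eta> x
        + (x - of_real (2 * \<eta>)) * coulomb_phi l \<eta> x
      = exp (- (\<i> * x)) * (2 * \<i>) * (2 * \<i> * x * ?K 2 + (?b - 2 * \<i> * x) * ?K 1 - ?a * ?K 0)"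
    unfolding coulomb_phi_def coulomb_phi'_def coulomb_phi''_def Let_def hyp1F1_eq_kummer_deriv
    by (simp add: algebra_simps)
  also have "\<dots> = 0"
    using kummer_ode[OF coulomb_denominator_nonzero[OF assms], of "2 * \<i> * x" ?a] by simp
  finally show ?thesis .
qed

lemma coulomb_phi_0: "coulomb_phi l \<eta> 0 = 1"
  using powser_zero[of "kummer_coeff a b" for a b]
  by (simp add: coulomb_phi_def hyp1F1_eq_kummer_deriv kummer_deriv_def) (simp add: kummer_coeff_def)

lemma coulomb_C_nonzero:
  assumes "l > -3/2" "l \<noteq> -1"
  shows "coulomb_C l \<eta> \<noteq> 0"
proof -
  have "2 * l + 2 \<notin> \<int>\<^sub>\<le>\<^sub>0"
  proof
    assume "2 * l + 2 \<in> \<int>\<^sub>\<le>\<^sub>0"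
    then obtain n where "2 * l + 2 = - real n" by (auto elim: nonpos_Ints_cases')
    with assms show False by (cases n) auto
  qed
  moreover have "of_real l + 1 + \<i> * of_real \<eta> \<notin> (\<int>\<^sub>\<le>\<^sub>0 :: complex set)"
  proof
    assume "of_real l + 1 + \<i> * of_real \<eta> \<in> (\<int>\<^sub>\<le>\<^sub>0 :: complex set)"
    then obtain n where "of_real l + 1 + \<i> * of_real \<eta> = - (of_nat n :: complex)"
      by (auto elim: nonpos_Ints_cases')
    then have "l + 1 = - real n" by (auto simp: complex_eq_iff)
    with assms show False by (cases n) auto
  qed
  ultimately show ?thesis by (simp add: coulomb_C_def Gamma_eq_zero_iff)
qed

lemma deriv_coulomb_F:
  assumes "l > -3/2" "l \<noteq> -1" and x: "x \<notin> \<real>"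
  shows "x * deriv (coulomb_F l \<eta>) x + of_real h * coulomb_F l \<eta> x
       = of_real (coulomb_C l \<eta>) * x powr (of_real l + 1)
         * (x * coulomb_phi' l \<eta> x + of_real (h + l + 1) * coulomb_phi l \<eta> x)"
proof -
  have x0: "x \<noteq> 0" "x \<notin> \<real>\<^sub>\<le>\<^sub>0" using x by (auto elim: nonpos_Reals_cases)
  have "(coulomb_F l \<eta> has_field_derivative
      of_real (coulomb_C l \<eta>) * ((of_real l + 1) * x powr (of_real l + 1 - 1)) * coulomb_phi l \<eta> x
      + of_real (coulomb_C l \<eta>) * x powr (of_real l + 1) * coulomb_phi' l \<eta> x) (at x)"
    unfolding coulomb_F_def[abs_def]
    by (rule derivative_eq_intros has_field_derivative_powr x0
        has_field_derivative_coulomb_phi[OF assms(1,2)] refl)+ simp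
  note d = DERIV_imp_deriv[OF this]
  have "x powr (of_real l + 1) = x * x powr of_real l"
    using x0 by (simp add: powr_add)
  then show ?thesis
    unfolding d by (simp add: coulomb_F_def algebra_simps)
qed

theorem theorem5p2:
  fixes l \<eta> h :: real
  assumes "l > -3/2" and "l \<noteq> -1" and "\<eta> \<noteq> 0" and "h \<ge> - l - 1"
  shows "\<forall>x :: complex.
    x * deriv (coulomb_F l \<eta>) x + of_real h * coulomb_F l \<eta> x = 0 \<longrightarrow> x \<in> \<real>"
proof (intro allI impI, rule ccontr)
  fix x :: complex
  assume zero: "x * deriv (coulomb_F l \<eta>) x + of_real h * coulomb_F l \<eta> x = 0" and x: "x \<notin> \<real>"
  then have "x \<noteq> 0" by auto
  with zero have "x * coulomb_phi' l \<eta> x + of_real (h + l + 1) * coulomb_phi l \<eta> x = 0"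
    unfolding deriv_coulomb_F[OF assms(1,2) x] using coulomb_C_nonzero[OF assms(1,2)]
    by (simp del: of_real_add)
  then have "x \<in> \<real>"
    using assms
    by (intro ray_no_nonreal_zeros[of "coulomb_phi l \<eta>" "coulomb_phi' l \<eta>" "coulomb_phi'' l \<eta>"
          "2 * l + 2" "2 * \<eta>" "h + l + 1"] has_field_derivative_coulomb_phi
          has_field_derivative_coulomb_phi' coulomb_phi_ode)
       (simp_all add: coulomb_phi_0)
  with x show False ..
qed

end
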